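(* Let $(X,\mathcal{D})$ be a metric space of log-covering dimension $d$. Then the Lipschitz experts problem (with full feedback) on $(X,\mathcal{D})$ is $t^\gamma$-tractable for any $\gamma>\frac{d+1}{d+2}$.
   Context: Lipschitz experts problem on $(X,\mathcal{D})$ (diameter at most 1, known): an instance is an unknown Borel probability measure $\mathbb{P}$ on $[0,1]^X$ such that $\mu(x)=\mathbb{E}_{f\sim\mathbb{P}}[f(x)]$ is $1$-Lipschitz w.r.t. $\mathcal{D}$. Each round the algorithm picks $x_t$, $f_t\sim\mathbb{P}$ is drawn independently, the algorithm receives $f_t(x_t)$ and observes $f_t$ (may query it at any finite number of points). Regret $R(t)=t\sup\mu-\mathbb{E}[\sum_{s\le t}\mu(x_s)]$. $t^\gamma$-tractable: there is an algorithm such that for each instance there is a constant $C$ with $R(t)\le Ct^\gamma$ for all $t$. Log-covering dimension: $\mathrm{LCD}(X)=\limsup_{r\to0}\frac{\log\log N_r(X)}{\log(1/r)}$, where $N_r(X)$ is the smallest number of sets of diameter at most $r$ sufficient to cover $X$. *)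

theory Defs
  imports "HOL-Probability.Probability"
begin

definition covering_number :: "'a::metric_space set \<Rightarrow> real \<Rightarrow> enat" where
  "covering_number A r =
     (INF \<U> \<in> {\<U>. finite \<U> \<and> A \<subseteq> \<Union>\<U> \<and> (\<forall>U\<in>\<U>. bounded U \<and> diameter U \<le> r)}. enat (card \<U>))"

text \<open>If \<open>N = \<infinity>\<close> the iterated logarithm is \<open>\<infinity>\<close>. For \<open>N = 1\<close> the library value \<open>ln 0 = 0\<close>
  is used; this case persists as \<open>r \<rightarrow> 0\<close> only for a one-point space, which thus has
  log-covering dimension \<open>0\<close>.\<close>

definition log_log :: "enat \<Rightarrow> ereal" where
  "log_log N = (case N of enat n \<Rightarrow> ereal (ln (ln (real n))) | \<infinity> \<Rightarrow> \<infinity>)"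

definition log_covering_dim :: "'a::metric_space set \<Rightarrow> ereal" where
  "log_covering_dim A =
     Limsup (at_right 0) (\<lambda>r. log_log (covering_number A r) / ereal (ln (1 / r)))"

text \<open>The topology on the function type is the product topology, so the following is the Borel
  \<open>\<sigma>\<close>-algebra of \<open>[0,1]\<^sup>X\<close> (only its space and measurable sets matter).\<close>

definition payoff_space :: "('a \<Rightarrow> real) measure" where
  "payoff_space = restrict_space borel {f. \<forall>x. f x \<in> {0..1}}"

definition mean_payoff :: "('a \<Rightarrow> real) measure \<Rightarrow> 'a \<Rightarrow> real" where
  "mean_payoff P x = (\<integral>f. f x \<partial>P)"

definition lipschitz_instance :: "('a::metric_space \<Rightarrow> real) measure \<Rightarrow> bool" where
  "lipschitz_instance P \<longleftrightarrow>
     prob_space P \<and> sets P = sets payoff_space \<and> 1-lipschitz_on UNIV (mean_payoff P)"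

text \<open>An adaptive strategy for querying a payoff function. Since datatypes are well-founded, every
  run asks only finitely many queries, without a uniform bound on their number.\<close>

datatype 'a query_tree = Stop | Query 'a "real \<Rightarrow> 'a query_tree"

primrec answers :: "'a query_tree \<Rightarrow> ('a \<Rightarrow> real) \<Rightarrow> ('a \<times> real) list" where
  "answers Stop f = []"
| "answers (Query x k) f = (x, f x) # answers (k (f x)) f"

text \<open>Record of one round: the point picked, the payoff received, the queries with their answers.\<close>

type_synonym 'a round = "'a \<times> real \<times> ('a \<times> real) list"

text \<open>A randomized algorithm draws a random seed once, before the first round. Given the seed and
  the past rounds, \<open>pick\<close> is the next point; given in addition the payoff received for that
  point, \<open>query\<close> is the strategy for querying the current payoff function.\<close>

datatype 'a experts_algorithm = Experts_Algorithm
  (seed: "real measure")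
  (pick: "real \<Rightarrow> 'a round list \<Rightarrow> 'a")
  (query: "real \<Rightarrow> 'a round list \<Rightarrow> real \<Rightarrow> 'a query_tree")

text \<open>Rounds are numbered from \<open>0\<close>: the payoff function of round \<open>t\<close> is \<open>F t\<close>, and
  \<open>history A \<omega> F t\<close> lists the rounds before round \<open>t\<close>.\<close>

primrec history ::
  "'a experts_algorithm \<Rightarrow> real \<Rightarrow> (nat \<Rightarrow> 'a \<Rightarrow> real) \<Rightarrow> nat \<Rightarrow> 'a round list" where
  "history A \<omega> F 0 = []"
| "history A \<omega> F (Suc t) =
     (let h = history A \<omega> F t; x = pick A \<omega> h; y = F t x
      in h @ [(x, y, answers (query A \<omega> h y) (F t))])"

definition chosen ::
  "'a experts_algorithm \<Rightarrow> real \<Rightarrow> (nat \<Rightarrow> 'a \<Rightarrow> real) \<Rightarrow> nat \<Rightarrow> 'a" where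
  "chosen A \<omega> F t = pick A \<omega> (history A \<omega> F t)"

text \<open>The measurability condition makes every chosen point a random variable, for every instance.\<close>

definition valid_algorithm :: "'a::metric_space experts_algorithm \<Rightarrow> bool" where
  "valid_algorithm A \<longleftrightarrow>
     prob_space (seed A) \<and> sets (seed A) = sets borel \<and>
     (\<forall>t. (\<lambda>(\<omega>, F). chosen A \<omega> F t)
            \<in> borel_measurable (seed A \<Otimes>\<^sub>M (\<Pi>\<^sub>M s\<in>(UNIV::nat set). payoff_space)))"

definition regret :: "'a experts_algorithm \<Rightarrow> ('a \<Rightarrow> real) measure \<Rightarrow> nat \<Rightarrow> real" where
  "regret A P t =
     real t * (SUP x. mean_payoff P x)
     - (\<integral>(\<omega>, F). (\<Sum>s<t. mean_payoff P (chosen A \<omega> F s))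
          \<partial>(seed A \<Otimes>\<^sub>M (\<Pi>\<^sub>M s\<in>(UNIV::nat set). P)))"

definition experts_tractable :: "'a::metric_space itself \<Rightarrow> real \<Rightarrow> bool" where
  "experts_tractable _ \<gamma> \<longleftrightarrow>
     (\<exists>A::'a experts_algorithm. valid_algorithm A \<and>
        (\<forall>P. lipschitz_instance P \<longrightarrow> (\<exists>C. \<forall>t. regret A P t \<le> C * real t powr \<gamma>)))"

end

theory Submission
  imports Defs "HOL-Probability.Hoeffding" "HOL-Real_Asymp.Real_Asymp"
begin

text \<open>In round \<open>t\<close> play the point with the best empirical payoff, over the rounds since \<open>t / 2\<close>,
  among a finite net at scale \<open>r = t powr (\<gamma> - 1)\<close>. Such a net may be chosen with
  \<open>ln N \<le> r powr - b\<close> points for some \<open>b > d\<close>, so by Hoeffding's lemma and a union bound the expected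
  loss of the round is of order \<open>r + sqrt (ln N / t)\<close>, which is \<open>O(r)\<close> once \<open>r powr - (b + 2) \<le> t\<close>; this
  is possible precisely because \<open>(1 - \<gamma>) * (d + 2) < 1\<close>. Summing over the rounds gives
  \<open>O(t powr \<gamma>)\<close>.\<close>

section \<open>Covering numbers and finite nets\<close>

lemma finite_net_of_covering_number:
  assumes "covering_number (UNIV :: 'a::metric_space set) r = enat N"
  obtains S :: "'a::metric_space set"
    where "finite S" "S \<noteq> {}" "card S \<le> N" "\<And>x. \<exists>y\<in>S. dist x y \<le> r"
proof -
  let ?C = "{\<U> :: 'a set set. finite \<U> \<and> UNIV \<subseteq> \<Union>\<U> \<and> (\<forall>U\<in>\<U>. bounded U \<and> diameter U \<le> r)}"
  \<comment> \<open>An infimum over no covers would be infinite, contradicting the value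
    \<open>enat N\<close>. Since \<open>enat\<close> is well-ordered, the infimum is then attained
    by an actual cover, and one point from each nonempty member is a net.\<close>
  have "?C \<noteq> {}"
    using assms by (auto simp: covering_number_def Inf_enat_def split: if_splits)
  then obtain \<V> where "\<V> \<in> ?C" by blast
  then have "covering_number (UNIV :: 'a set) r \<in> (\<lambda>\<U>. enat (card \<U>)) ` ?C"
    unfolding covering_number_def by (intro wellorder_InfI[OF imageI])
  then obtain \<U> :: "'a set set" where \<U>: "finite \<U>" "UNIV \<subseteq> \<Union>\<U>"
      "\<And>U. U \<in> \<U> \<Longrightarrow> bounded U \<and> diameter U \<le> r" "card \<U> = N"
    using assms by auto
  define S where "S = (\<lambda>U. SOME x. x \<in> U) ` (\<U> - {{}})"
  show ?thesis
  proof
    show "finite S" using \<U> by (simp add: S_def)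
    have "card S \<le> card (\<U> - {{}})" unfolding S_def using \<U> by (intro card_image_le) auto
    also have "\<dots> \<le> N" using card_Diff1_le[of \<U> "{}"] \<U>(4) by simp
    finally show "card S \<le> N" .
    show near: "\<exists>y\<in>S. dist x y \<le> r" for x
    proof -
      obtain U where U: "U \<in> \<U>" "x \<in> U" using \<U>(2) by blast
      then have "(SOME x. x \<in> U) \<in> U" by (intro someI)
      with U have "dist x (SOME x. x \<in> U) \<le> diameter U"
        using \<U>(3) by (intro diameter_bounded_bound) auto
      also have "\<dots> \<le> r" using U \<U>(3) by blast
      finally show ?thesis
        using U by (intro bexI[of _ "SOME x. x \<in> U"]) (auto simp: S_def)
    qed
    from near[of undefined] show "S \<noteq> {}" by auto
  qed
qed

lemma covering_number_UNIV_pos: "covering_number (UNIV :: 'a::metric_space set) r \<noteq> 0"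
proof
  assume "covering_number (UNIV :: 'a set) r = 0"
  then obtain S :: "'a set" where "finite S" "S \<noteq> {}" "card S \<le> 0"
    using finite_net_of_covering_number[of r 0] by (metis zero_enat_def)
  then show False by simp
qed

text \<open>The iterated logarithm never falls below \<open>ln (ln 2)\<close>: for N = 1 it is
  \<open>ln 0 = 0\<close>, which is larger. Divided by \<open>ln (1 / r)\<close>, this constant
  tends to 0. The sign of d later places (d + 1) / (d + 2) strictly between 0 and 1.\<close>

lemma log_covering_dim_nonneg: "log_covering_dim (UNIV :: 'a::metric_space set) \<ge> 0"
proof -
  have lim: "((\<lambda>r::real. ereal (ln (ln 2) / ln (1 / r))) \<longlongrightarrow> ereal 0) (at_right 0)"
    by (intro tendsto_ereal) real_asymp
  have "Limsup (at_right 0) (\<lambda>r::real. ereal (ln (ln 2) / ln (1 / r))) = 0"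
    using lim_imp_Limsup[OF _ lim] by (simp add: zero_ereal_def)
  moreover have "Limsup (at_right 0) (\<lambda>r::real. ereal (ln (ln 2) / ln (1 / r)))
      \<le> log_covering_dim (UNIV :: 'a set)"
    unfolding log_covering_dim_def
  proof (rule Limsup_mono)
    have "\<forall>\<^sub>F r::real in at_right 0. r \<in> {0<..<1}"
      by (rule eventually_at_right_real) simp
    then show "\<forall>\<^sub>F r in at_right 0. ereal (ln (ln 2) / ln (1 / r))
        \<le> log_log (covering_number (UNIV :: 'a set) r) / ereal (ln (1 / r))"
    proof eventually_elim
      case (elim r)
      then have pos: "ln (1 / r) > 0" by (simp add: ln_div)
      show ?case
      proof (cases "covering_number (UNIV :: 'a set) r")
        case (enat n)
        with covering_number_UNIV_pos[where 'a='a, of r] have "n \<noteq> 0"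
          by (auto simp: zero_enat_def)
        then consider "n = 1" | "n \<ge> 2" by linarith
        then have "ln (ln 2) \<le> ln (ln (real n))"
        proof cases
          case 1
          then show ?thesis using ln_2_less_1 by simp
        next
          case 2
          then show ?thesis by simp
        qed
        with pos enat show ?thesis by (simp add: log_log_def divide_right_mono)
      qed (use pos in \<open>simp add: log_log_def\<close>)
    qed
  qed
  ultimately show ?thesis by simp
qed

text \<open>A limsup strictly below b gives \<open>ln (ln N) < b * ln (1 / r)\<close> for all small
  r; exponentiating once yields the bound on \<open>ln N\<close>.\<close>

lemma eventually_net_of_log_covering_dim:
  assumes "log_covering_dim (UNIV :: 'a::metric_space set) < ereal b"
  shows "\<forall>\<^sub>F r in at_right 0. \<exists>S :: 'a set. finite S \<and> S \<noteq> {} \<and>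
    ln (card S) \<le> r powr - b \<and> (\<forall>x. \<exists>y\<in>S. dist x y \<le> r)"
proof -
  have "\<forall>\<^sub>F r::real in at_right 0. r \<in> {0<..<1}"
    by (rule eventually_at_right_real) simp
  with Limsup_lessD[OF assms[unfolded log_covering_dim_def]] show ?thesis
  proof eventually_elim
    case (elim r)
    then have pos: "ln (1 / r) > 0" by (simp add: ln_div)
    obtain N where N: "covering_number (UNIV :: 'a set) r = enat N"
      using elim pos by (cases "covering_number (UNIV :: 'a set) r") (auto simp: log_log_def)
    with elim pos have less: "ln (ln (real N)) < b * ln (1 / r)"
      by (simp add: log_log_def pos_divide_less_eq)
    have "ln (real N) \<le> r powr - b"
    proof (cases "N \<ge> 2")
      case True
      then have "ln (real N) = exp (ln (ln (real N)))" by simp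
      also have "\<dots> \<le> exp (b * ln (1 / r))" using less by simp
      also have "\<dots> = r powr - b" using elim by (simp add: powr_def ln_div)
      finally show ?thesis .
    next
      \<comment> \<open>Here \<open>ln N = 0\<close>, so it cannot be recovered as
        \<open>exp (ln (ln N))\<close>, but the bound is trivial.\<close>
      case False
      then have "N = 0 \<or> N = 1" by linarith
      then show ?thesis by auto
    qed
    moreover obtain S :: "'a set" where S: "finite S" "S \<noteq> {}" "card S \<le> N"
        "\<And>x. \<exists>y\<in>S. dist x y \<le> r"
      using finite_net_of_covering_number[OF N] by blast
    moreover from S have "ln (real (card S)) \<le> ln (real N)"
      by (intro ln_mono) (auto simp: card_gt_0_iff)
    ultimately show ?case by (intro exI[of _ S] conjI allI) linarith+
  qed
qed

section \<open>Maximizers over a finite set\<close>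

lemma arg_max_on_cong:
  assumes "\<And>x. x \<in> S \<Longrightarrow> f x = g x"
  shows "arg_max_on f S = arg_max_on g S"
proof -
  have "is_arg_max f (\<lambda>x. x \<in> S) = is_arg_max g (\<lambda>x. x \<in> S)"
    using assms by (auto simp: is_arg_max_def fun_eq_iff)
  then show ?thesis by (simp add: arg_max_on_def arg_max_def)
qed

lemma arg_max_on_finite:
  fixes f :: "'a \<Rightarrow> real"
  assumes "finite S" "S \<noteq> {}"
  shows "arg_max_on f S \<in> S" "\<And>y. y \<in> S \<Longrightarrow> f y \<le> f (arg_max_on f S)"
proof -
  have "Max (f ` S) \<in> f ` S" using assms by simp
  then obtain x where "x \<in> S" "f x = Max (f ` S)" by auto
  then have "is_arg_max f (\<lambda>x. x \<in> S) x"
    using assms by (simp add: is_arg_max_linorder)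
  then have "is_arg_max f (\<lambda>x. x \<in> S) (arg_max_on f S)"
    unfolding arg_max_on_def arg_max_def by (rule someI)
  then show "arg_max_on f S \<in> S" "\<And>y. y \<in> S \<Longrightarrow> f y \<le> f (arg_max_on f S)"
    by (auto simp: is_arg_max_linorder)
qed

text \<open>The selected point depends on the outcome only through the set of maximizers, which is a
  measurable map into the finite discrete space of subsets of \<open>S\<close>. Every function on a
  discrete space is measurable, so breaking ties by \<open>SOME\<close> does no harm.\<close>

lemma measurable_arg_max_on:
  fixes g :: "'a \<Rightarrow> 'b \<Rightarrow> real"
  assumes "finite S" "space N = UNIV"
    and meas [measurable]: "\<And>x. x \<in> S \<Longrightarrow> g x \<in> borel_measurable M"
  shows "(\<lambda>\<omega>. arg_max_on (\<lambda>x. g x \<omega>) S) \<in> measurable M N"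
proof -
  let ?A = "\<lambda>\<omega>. {x \<in> S. \<forall>y\<in>S. g y \<omega> \<le> g x \<omega>}"
  have "?A \<in> measurable M (count_space (Pow S))"
  proof (subst measurable_count_space_eq2)
    show "?A \<in> space M \<rightarrow> Pow S \<and> (\<forall>T\<in>Pow S. ?A -` {T} \<inter> space M \<in> sets M)"
    proof (intro conjI ballI)
      fix T assume T: "T \<in> Pow S"
      have "?A -` {T} \<inter> space M =
          {\<omega> \<in> space M. \<forall>x\<in>S. x \<in> T \<longleftrightarrow> (\<forall>y\<in>S. g y \<omega> \<le> g x \<omega>)}"
        using T by blast
      also have "\<dots> \<in> sets M" using \<open>finite S\<close> by measurable
      finally show "?A -` {T} \<inter> space M \<in> sets M" .
    qed auto
  qed (use \<open>finite S\<close> in simp)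
  then have "(\<lambda>\<omega>. SOME x. x \<in> ?A \<omega>) \<in> measurable M N"
    using assms(2) by (intro measurable_compose[where f = ?A and g = "\<lambda>T. SOME x. x \<in> T"]) auto
  then show ?thesis
    by (simp add: arg_max_on_def arg_max_def is_arg_max_linorder Ball_def)
qed

section \<open>The algorithm and its choices\<close>

primrec query_all :: "'a list \<Rightarrow> 'a query_tree" where
  "query_all [] = Stop"
| "query_all (x # xs) = Query x (\<lambda>_. query_all xs)"

text \<open>Repeated points are harmless: all entries for \<open>x\<close> carry the same value
  \<open>f x\<close>.\<close>

lemma map_of_answers_query_all:
  "x \<in> set xs \<Longrightarrow> map_of (answers (query_all xs) f) x = Some (f x)"
  by (induction xs) auto

text \<open>Round \<open>t\<close> uses the payoffs of the rounds in \<open>{t div 2..<t}\<close>; hence the payoff function of round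
  \<open>s\<close> is consulted only up to round \<open>2 * s + 1\<close>, which is what makes its query list finite although
  the nets get finer forever.\<close>

definition follow_the_leader :: "(nat \<Rightarrow> 'a list) \<Rightarrow> 'a experts_algorithm" where
  "follow_the_leader net = Experts_Algorithm (return borel 0)
     (\<lambda>_ h. arg_max_on
        (\<lambda>x. \<Sum>s\<in>{length h div 2..<length h}. the (map_of (snd (snd (h ! s))) x))
        (set (net (length h))))
     (\<lambda>_ h _. query_all (concat (map net [0..<2 * length h + 2])))"

lemma pick_follow_the_leader:
  "pick (follow_the_leader net) \<omega> h = arg_max_on
     (\<lambda>x. \<Sum>s\<in>{length h div 2..<length h}. the (map_of (snd (snd (h ! s))) x))
     (set (net (length h)))"
  by (simp add: follow_the_leader_def)

lemma query_follow_the_leader: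
  "query (follow_the_leader net) \<omega> h y = query_all (concat (map net [0..<2 * length h + 2]))"
  by (simp add: follow_the_leader_def)

lemma length_history [simp]: "length (history A \<omega> F t) = t"
  by (induction t) (auto simp: Let_def)

lemma history_nth:
  assumes "s < t"
  shows "history A \<omega> F t ! s = (let h = history A \<omega> F s; x = pick A \<omega> h; y = F s x
      in (x, y, answers (query A \<omega> h y) (F s)))"
  using assms
proof (induction t)
  case (Suc t)
  then show ?case
    by (cases "s = t") (simp_all add: Let_def nth_append)
qed simp

text \<open>This removes the recursion through histories: the choice is an explicit function of the
  payoffs alone, so the analysis can work directly on the product measure.\<close>

lemma chosen_follow_the_leader:
  "chosen (follow_the_leader net) \<omega> F t =
     arg_max_on (\<lambda>x. \<Sum>s\<in>{t div 2..<t}. F s x) (set (net t))"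
proof -
  have "the (map_of (snd (snd (history (follow_the_leader net) \<omega> F t ! s))) x) = F s x"
    if "s \<in> {t div 2..<t}" "x \<in> set (net t)" for s x
  proof -
    \<comment> \<open>From \<open>t div 2 <= s\<close> follows t <= 2 * s + 1, so
      \<open>net t\<close> is among the nets queried in round s.\<close>
    have "t < 2 * s + 2" using that(1) by auto
    then have "x \<in> set (concat (map net [0..<2 * s + 2]))"
      using that(2) by (auto simp del: upt_Suc)
    from map_of_answers_query_all[OF this, of "F s"] show ?thesis
      using that(1)
      by (simp add: history_nth Let_def query_follow_the_leader del: upt_Suc)
  qed
  then show ?thesis
    unfolding chosen_def pick_follow_the_leader length_history
    by (intro arg_max_on_cong sum.cong) auto
qed

text \<open>Telescoping: by the mean value theorem the increment of the p-th power from t to t + 1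
  is p * z powr (p - 1) with z < t + 1, and the exponent p - 1 is negative. The step from 0 is
  checked directly, as the derivative is singular there.\<close>

lemma sum_powr_le:
  fixes p :: real
  assumes "0 < p" "p < 1"
  shows "(\<Sum>s<t. (real s + 1) powr (p - 1)) \<le> real t powr p / p"
proof (induction t)
  case (Suc t)
  have "p * (real t + 1) powr (p - 1) \<le> (real t + 1) powr p - real t powr p"
  proof (cases "t = 0")
    case False
    then have "\<exists>z>real t. z < real t + 1 \<and>
        (real t + 1) powr p - real t powr p = (real t + 1 - real t) * (p * z powr (p - 1))"
      by (intro MVT2) (auto intro!: derivative_eq_intros simp: powr_diff)
    then obtain z where "z > real t" "z < real t + 1"
        "(real t + 1) powr p - real t powr p = p * z powr (p - 1)" by auto
    moreover from this have "(real t + 1) powr (p - 1) \<le> z powr (p - 1)"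
      using assms by (intro powr_mono2') auto
    ultimately show ?thesis using assms by simp
  qed (use assms in simp)
  with Suc show ?case using assms by (simp add: field_simps)
qed simp

section \<open>Measurability and integrals over independent rounds\<close>

lemma measurable_payoff_eval [measurable]: "(\<lambda>f. f x) \<in> borel_measurable payoff_space"
  unfolding payoff_space_def
  by (intro measurable_restrict_space1 borel_measurable_continuous_onI
      continuous_on_product_coordinates)

lemma space_payoff_space: "space payoff_space = {f. \<forall>x. f x \<in> {0..1}}"
  by (simp add: payoff_space_def space_restrict_space)

lemma valid_follow_the_leader: "valid_algorithm (follow_the_leader net)"
proof -
  have seed: "seed (follow_the_leader net) = return borel 0"
    by (simp add: follow_the_leader_def)
  have "(\<lambda>z. arg_max_on (\<lambda>x. \<Sum>s\<in>{t div 2..<t}. snd z s x) (set (net t)))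
      \<in> borel_measurable (return borel (0::real) \<Otimes>\<^sub>M (\<Pi>\<^sub>M s\<in>(UNIV::nat set). payoff_space))" for t
    by (intro measurable_arg_max_on) (auto intro!: borel_measurable_sum)
  then show ?thesis
    unfolding valid_algorithm_def seed chosen_follow_the_leader case_prod_unfold
    by (auto intro: prob_space_return)
qed

text \<open>The integrand sees only the coordinates in \<open>W\<close>. Restriction to
  \<open>W\<close> pushes the infinite product forward to a finite one, where the integral of the
  product factorizes.\<close>

lemma PiM_coordinates_prod:
  fixes g :: "'b \<Rightarrow> real" and W :: "'i set"
  assumes "prob_space P" "finite W" "integrable P g"
  shows integrable_PiM_coordinates_prod:
      "integrable (\<Pi>\<^sub>M s\<in>UNIV. P) (\<lambda>F. \<Prod>s\<in>W. g (F s))"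
    and integral_PiM_coordinates_prod:
      "(\<integral>F. (\<Prod>s\<in>W. g (F s)) \<partial>(\<Pi>\<^sub>M s\<in>UNIV. P)) = (\<integral>f. g f \<partial>P) ^ card W"
proof -
  interpret P: prob_space P by fact
  interpret Q: product_prob_space "\<lambda>_::'i. P" UNIV by unfold_locales
  have [measurable]: "g \<in> borel_measurable P" using assms by auto
  have restr: "distr (\<Pi>\<^sub>M s\<in>UNIV. P) (\<Pi>\<^sub>M s\<in>W. P) (\<lambda>F. restrict F W) = (\<Pi>\<^sub>M s\<in>W. P)"
    using assms by (intro Q.distr_PiM_restrict_finite) auto
  have meas: "(\<lambda>F. restrict F W) \<in> measurable (\<Pi>\<^sub>M s\<in>UNIV. P) (\<Pi>\<^sub>M s\<in>W. P)"
    by (intro measurable_restrict_subset) simp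
  have "integrable (\<Pi>\<^sub>M s\<in>W. P) (\<lambda>F. \<Prod>s\<in>W. g (F s))"
    using assms by (intro Q.product_integrable_prod) auto
  then have "integrable (\<Pi>\<^sub>M s\<in>UNIV. P) (\<lambda>F. \<Prod>s\<in>W. g (restrict F W s))"
    by (subst (asm) restr[symmetric]) (rule integrable_distr[OF meas])
  then show "integrable (\<Pi>\<^sub>M s\<in>UNIV. P) (\<lambda>F. \<Prod>s\<in>W. g (F s))" by simp
  have "(\<integral>F. (\<Prod>s\<in>W. g (F s)) \<partial>(\<Pi>\<^sub>M s\<in>UNIV. P))
      = (\<integral>F. (\<Prod>s\<in>W. g (restrict F W s)) \<partial>(\<Pi>\<^sub>M s\<in>UNIV. P))" by simp
  also have "\<dots> = (\<integral>F. (\<Prod>s\<in>W. g (F s)) \<partial>distr (\<Pi>\<^sub>M s\<in>UNIV. P) (\<Pi>\<^sub>M s\<in>W. P) (\<lambda>F. restrict F W))"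
    by (rule integral_distr[symmetric, OF meas]) measurable
  also have "\<dots> = (\<integral>F. (\<Prod>s\<in>W. g (F s)) \<partial>(\<Pi>\<^sub>M s\<in>W. P))" by (simp only: restr)
  also have "\<dots> = (\<Prod>s\<in>W. \<integral>f. g f \<partial>P)"
    using assms by (intro Q.product_integral_prod) auto
  finally show "(\<integral>F. (\<Prod>s\<in>W. g (F s)) \<partial>(\<Pi>\<^sub>M s\<in>UNIV. P)) = (\<integral>f. g f \<partial>P) ^ card W" by simp
qed

section \<open>Expected loss for a fixed instance\<close>

context
  fixes P :: "('a::metric_space \<Rightarrow> real) measure"
  assumes P: "lipschitz_instance P"
begin

interpretation P: prob_space P
  using P by (simp add: lipschitz_instance_def)

lemma sets_lipschitz_instance [measurable_cong]: "sets P = sets payoff_space"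
  using P by (simp add: lipschitz_instance_def)

lemma payoff_bounds: "f \<in> space P \<Longrightarrow> 0 \<le> f x \<and> f x \<le> 1"
  using sets_eq_imp_space_eq[OF sets_lipschitz_instance] by (auto simp: space_payoff_space)

interpretation payoff: interval_bounded_random_variable P "\<lambda>f. f x" 0 1 for x
  by unfold_locales (use payoff_bounds in auto)

interpretation Q: product_prob_space "\<lambda>_. P" "UNIV :: nat set"
  by unfold_locales

lemma mean_payoff_bounds: "0 \<le> mean_payoff P x" "mean_payoff P x \<le> 1"
  using payoff_bounds unfolding mean_payoff_def
  by (auto intro!: integral_nonneg_AE P.integral_le_const)

lemma bdd_above_mean_payoff: "bdd_above (range (mean_payoff P))"
  using mean_payoff_bounds by (intro bdd_aboveI2[of _ _ 1]) auto

lemma SUP_mean_payoff_bounds: "0 \<le> (SUP x. mean_payoff P x)" "(SUP x. mean_payoff P x) \<le> 1"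
  using mean_payoff_bounds cSUP_upper2[OF bdd_above_mean_payoff, of undefined 0]
  by (auto intro!: cSUP_least)

lemma borel_measurable_mean_payoff [measurable]: "mean_payoff P \<in> borel_measurable borel"
  using P by (auto simp: lipschitz_instance_def
      intro: borel_measurable_continuous_onI lipschitz_on_continuous_on)

lemma integral_payoff_coordinate: "(\<integral>F. F s x \<partial>(\<Pi>\<^sub>M s\<in>(UNIV :: nat set). P)) = mean_payoff P x"
  and integrable_payoff_coordinate: "integrable (\<Pi>\<^sub>M s\<in>(UNIV :: nat set). P) (\<lambda>F. F s x)"
  using integral_PiM_coordinates_prod[OF P.prob_space_axioms, of "{s}" "\<lambda>f. f x"]
    integrable_PiM_coordinates_prod[OF P.prob_space_axioms, of "{s}" "\<lambda>f. f x"] payoff.integrable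
  by (auto simp: mean_payoff_def)

text \<open>Independence turns the moment generating function of the sum into a power of that of one
  centred payoff, to which Hoeffding's lemma on [0,1] applies.\<close>

lemma exp_deviation_mgf:
  fixes l :: real and x :: 'a
  assumes "finite W" "0 < l"
  defines "D \<equiv> \<lambda>F. exp (l * (\<Sum>s\<in>W. F s x - mean_payoff P x))"
  shows integrable_exp_deviation: "integrable (\<Pi>\<^sub>M s\<in>(UNIV :: nat set). P) D"
    and integral_exp_deviation_le:
      "(\<integral>F. D F \<partial>(\<Pi>\<^sub>M s\<in>(UNIV :: nat set). P)) \<le> exp (card W * l\<^sup>2 / 8)"
proof -
  let ?g = "\<lambda>f. exp (l * (f x - mean_payoff P x))"
  have D: "D = (\<lambda>F. \<Prod>s\<in>W. ?g (F s))"
    using assms by (simp add: D_def sum_distrib_left exp_sum)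
  have g: "integrable P ?g"
  proof (rule P.integrable_const_bound)
    show "AE f in P. norm (?g f) \<le> exp l"
    proof (rule AE_I2)
      fix f assume "f \<in> space P"
      then have "f x - mean_payoff P x \<le> 1"
        using payoff_bounds[of f x] mean_payoff_bounds[of x] by linarith
      then show "norm (?g f) \<le> exp l" using \<open>0 < l\<close> by (simp add: mult_left_le)
    qed
  qed measurable
  have "(\<integral>\<^sup>+f. ?g f \<partial>P) \<le> exp (l\<^sup>2 * (1 - 0)\<^sup>2 / 8)"
    using payoff.Hoeffdings_lemma_nn_integral[OF \<open>0 < l\<close>, of x] by (simp add: mean_payoff_def)
  then have "(\<integral>f. ?g f \<partial>P) \<le> exp (l\<^sup>2 / 8)"
    using g by (simp add: nn_integral_eq_integral)
  then have "(\<integral>f. ?g f \<partial>P) ^ card W \<le> exp (l\<^sup>2 / 8) ^ card W"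
    by (intro power_mono integral_nonneg_AE) auto
  also have "\<dots> = exp (card W * l\<^sup>2 / 8)" by (simp flip: exp_of_nat_mult)
  finally show "(\<integral>F. D F \<partial>(\<Pi>\<^sub>M s\<in>(UNIV :: nat set). P)) \<le> exp (card W * l\<^sup>2 / 8)"
    using integral_PiM_coordinates_prod[OF P.prob_space_axioms \<open>finite W\<close> g]
    by (simp add: D)
  show "integrable (\<Pi>\<^sub>M s\<in>(UNIV :: nat set). P) D"
    using integrable_PiM_coordinates_prod[OF P.prob_space_axioms \<open>finite W\<close> g] by (simp add: D)
qed

lemma integrable_mean_payoff_leader:
  assumes "finite S"
  shows "integrable (\<Pi>\<^sub>M s\<in>(UNIV :: nat set). P)
    (\<lambda>F. mean_payoff P (arg_max_on (\<lambda>x. \<Sum>s\<in>W. F s x) S))"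
proof (rule Q.P.integrable_const_bound)
  show "AE F in (\<Pi>\<^sub>M s\<in>(UNIV :: nat set). P).
      norm (mean_payoff P (arg_max_on (\<lambda>x. \<Sum>s\<in>W. F s x) S)) \<le> 1"
    using mean_payoff_bounds by simp
  have "(\<lambda>F. arg_max_on (\<lambda>x. \<Sum>s\<in>W. F s x) S)
      \<in> borel_measurable (\<Pi>\<^sub>M s\<in>(UNIV :: nat set). P)"
    using assms by (intro measurable_arg_max_on) (auto intro!: borel_measurable_sum)
  then show "(\<lambda>F. mean_payoff P (arg_max_on (\<lambda>x. \<Sum>s\<in>W. F s x) S))
      \<in> borel_measurable (\<Pi>\<^sub>M s\<in>(UNIV :: nat set). P)"
    by measurable
qed

text \<open>The random choice of the leader \<open>z\<close> is decoupled from its samples by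
  \<open>exp (l * D z) \<le> (\<Sum>x\<in>S. exp (l * D x))\<close>; the expectation of the logarithm then comes
  from the tangent inequality \<open>u \<le> exp (u - m) + m - 1\<close> at the best level \<open>m\<close>. The deviation of
  the optimal net point, which is not random, has mean \<open>0\<close>.\<close>

lemma expected_gap_leader:
  fixes l r :: real
  assumes S: "finite S" "S \<noteq> {}" "\<And>x. \<exists>y\<in>S. dist x y \<le> r"
    and W: "finite W" "W \<noteq> {}" and "0 < l"
  shows "(SUP x. mean_payoff P x) -
      (\<integral>F. mean_payoff P (arg_max_on (\<lambda>x. \<Sum>s\<in>W. F s x) S) \<partial>(\<Pi>\<^sub>M s\<in>(UNIV :: nat set). P))
    \<le> r + ln (card S) / (card W * l) + l / 8"
proof -
  let ?Q = "\<Pi>\<^sub>M s\<in>(UNIV :: nat set). P"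
  let ?\<mu> = "mean_payoff P"
  define z where "z = (\<lambda>F :: nat \<Rightarrow> 'a \<Rightarrow> real. arg_max_on (\<lambda>x. \<Sum>s\<in>W. F s x) S)"
  define y where "y = arg_max_on ?\<mu> S"
  define n where "n = real (card W)"
  \<comment> \<open>Chosen so that \<open>exp m = card S * exp (n * l^2 / 8)\<close>, the bound on
    the expected sum of exponentials over \<open>S\<close>; after normalization by
    \<open>exp (- m)\<close> that bound becomes exactly 1.\<close>
  define m where "m = ln (card S) + n * l\<^sup>2 / 8"
  define D where "D = (\<lambda>x (F :: nat \<Rightarrow> 'a \<Rightarrow> real). \<Sum>s\<in>W. F s x - ?\<mu> x)"
  have n: "n > 0" using W by (simp add: n_def card_gt_0_iff)
  have cS: "real (card S) > 0" using S by (simp add: card_gt_0_iff)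
  have y: "y \<in> S" "\<And>x. x \<in> S \<Longrightarrow> ?\<mu> x \<le> ?\<mu> y"
    using arg_max_on_finite[OF S(1,2), where f = ?\<mu>] by (auto simp: y_def)
  have z: "z F \<in> S" "\<And>x. x \<in> S \<Longrightarrow> (\<Sum>s\<in>W. F s x) \<le> (\<Sum>s\<in>W. F s (z F))" for F
    using arg_max_on_finite[OF S(1,2), where f = "\<lambda>x. \<Sum>s\<in>W. F s x"] by (auto simp: z_def)
  have SUP: "(SUP x. ?\<mu> x) \<le> ?\<mu> y + r"
  proof (rule cSUP_least)
    fix x
    obtain x' where x': "x' \<in> S" "dist x x' \<le> r" using S(3) by blast
    have "dist (?\<mu> x) (?\<mu> x') \<le> 1 * dist x x'"
      using P unfolding lipschitz_instance_def by (blast intro: lipschitz_onD)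
    then show "?\<mu> x \<le> ?\<mu> y + r" using y(2)[OF x'(1)] x'(2) by (simp add: dist_real_def)
  qed simp
  \<comment> \<open>A pointwise majorant of the gap in which the random leader no longer occurs:
    only fixed net points remain, so its expectation can be computed term by term.\<close>
  define B where "B = (\<lambda>F. r - D y F / n +
      (exp (- m) * (\<Sum>x\<in>S. exp (l * D x F)) + (m - 1)) / (n * l))"
  have gap: "(SUP x. ?\<mu> x) - ?\<mu> (z F) \<le> B F" for F
  proof -
    have D_eq: "D x F = (\<Sum>s\<in>W. F s x) - n * ?\<mu> x" for x
      by (simp add: D_def sum_subtractf n_def)
    \<comment> \<open>The leader's empirical sum is at least that of \<open>y\<close>, so a gap in
      means must be made up by deviations.\<close>
    have "n * (?\<mu> y - ?\<mu> (z F)) \<le> D (z F) F - D y F"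
      using z(2)[OF y(1), of F] by (simp add: D_eq algebra_simps)
    moreover have "l * D (z F) F \<le> exp (- m) * (\<Sum>x\<in>S. exp (l * D x F)) + (m - 1)"
    proof -
      have "l * D (z F) F - m + 1 \<le> exp (l * D (z F) F - m)"
        using exp_ge_add_one_self[of "l * D (z F) F - m"] by linarith
      also have "\<dots> = exp (- m) * exp (l * D (z F) F)"
        by (simp flip: exp_add)
      also have "\<dots> \<le> exp (- m) * (\<Sum>x\<in>S. exp (l * D x F))"
        using z(1)[of F] S(1) by (intro mult_left_mono member_le_sum) auto
      finally show ?thesis by simp
    qed
    ultimately have "?\<mu> y - ?\<mu> (z F) \<le>
        ((exp (- m) * (\<Sum>x\<in>S. exp (l * D x F)) + (m - 1)) / l - D y F) / n"
      using n \<open>0 < l\<close>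
      by (simp add: pos_le_divide_eq mult.commute) (smt (verit) pos_le_divide_eq mult.commute)
    with SUP n show ?thesis
      unfolding B_def by (simp add: diff_divide_distrib mult.commute)
  qed
  have D_int: "integrable ?Q (D y)" "(\<integral>F. D y F \<partial>?Q) = 0"
    using integrable_payoff_coordinate[of _ y] integral_payoff_coordinate[of _ y]
    by (simp_all add: D_def Q.P.prob_space)
  have B_int: "integrable ?Q B"
    using D_int integrable_exp_deviation[OF W(1) \<open>0 < l\<close>] unfolding B_def D_def by auto
  have "(\<integral>F. B F \<partial>?Q) = r + (exp (- m) * (\<Sum>x\<in>S. \<integral>F. exp (l * D x F) \<partial>?Q) + (m - 1)) / (n * l)"
    using D_int integrable_exp_deviation[OF W(1) \<open>0 < l\<close>] unfolding B_def D_def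
    by (simp add: Q.P.prob_space)
  also have "\<dots> \<le> r + (exp (- m) * (\<Sum>x\<in>S. exp (n * l\<^sup>2 / 8)) + (m - 1)) / (n * l)"
    using integral_exp_deviation_le[OF W(1) \<open>0 < l\<close>] n \<open>0 < l\<close> unfolding D_def n_def
    by (intro add_mono divide_right_mono mult_left_mono sum_mono) auto
  also have "exp (- m) * (\<Sum>x\<in>S. exp (n * l\<^sup>2 / 8)) = 1"
  proof -
    have "exp m = (\<Sum>x\<in>S. exp (n * l\<^sup>2 / 8))" using cS by (simp add: m_def exp_add)
    then have "exp (- m) * (\<Sum>x\<in>S. exp (n * l\<^sup>2 / 8)) = exp (- m) * exp m" by (simp only:)
    also have "\<dots> = 1" by (simp flip: exp_add)
    finally show ?thesis .
  qed
  also have "r + (1 + (m - 1)) / (n * l) = r + ln (card S) / (n * l) + l / 8"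
    using n \<open>0 < l\<close> by (simp add: m_def field_simps power2_eq_square)
  finally have "(\<integral>F. B F \<partial>?Q) \<le> r + ln (card S) / (n * l) + l / 8" .
  moreover have "(\<integral>F. (SUP x. ?\<mu> x) - ?\<mu> (z F) \<partial>?Q) \<le> (\<integral>F. B F \<partial>?Q)"
    using integrable_mean_payoff_leader[OF S(1)] gap B_int
    by (intro integral_mono) (auto simp: z_def)
  ultimately show ?thesis
    using integrable_mean_payoff_leader[OF S(1)] by (simp add: z_def n_def Q.P.prob_space)
qed

text \<open>For the finitely many early rounds, in which the net is not controlled.\<close>

lemma expected_gap_leader_le_1:
  "(SUP x. mean_payoff P x) -
      (\<integral>F. mean_payoff P (arg_max_on (\<lambda>x. \<Sum>s\<in>W. F s x) S) \<partial>(\<Pi>\<^sub>M s\<in>(UNIV :: nat set). P))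
    \<le> 1"
proof -
  have "0 \<le> (\<integral>F. mean_payoff P (arg_max_on (\<lambda>x. \<Sum>s\<in>W. F s x) S) \<partial>(\<Pi>\<^sub>M s\<in>(UNIV :: nat set). P))"
    using mean_payoff_bounds by (intro integral_nonneg_AE) simp
  then show ?thesis using SUP_mean_payoff_bounds by linarith
qed

lemma regret_follow_the_leader:
  "regret (follow_the_leader net) P t = (\<Sum>s<t. (SUP x. mean_payoff P x) -
     (\<integral>F. mean_payoff P (arg_max_on (\<lambda>x. \<Sum>i\<in>{s div 2..<s}. F i x) (set (net s)))
        \<partial>(\<Pi>\<^sub>M s\<in>(UNIV :: nat set). P)))"
proof -
  let ?Q = "\<Pi>\<^sub>M s\<in>(UNIV :: nat set). P"
  let ?c = "\<lambda>s F. mean_payoff P (arg_max_on (\<lambda>x. \<Sum>i\<in>{s div 2..<s}. F i x) (set (net s)))"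
  interpret seed: prob_space "return borel (0::real)" by (rule prob_space_return) simp
  interpret pair: pair_prob_space "return borel (0::real)" ?Q by unfold_locales
  have "integrable ?Q (\<lambda>F. \<Sum>s<t. ?c s F)"
    by (intro Bochner_Integration.integrable_sum integrable_mean_payoff_leader) simp
  \<comment> \<open>The seed is a point mass independent of the payoffs. Integrability is pulled
    back along the projection to the payoffs and the factors are swapped; Fubini then integrates the
    seed out.\<close>
  then have "integrable (?Q \<Otimes>\<^sub>M return borel (0::real)) (\<lambda>p. \<Sum>s<t. ?c s (fst p))"
    by (subst (asm) seed.distr_pair_fst[symmetric]) (rule integrable_distr[OF measurable_fst])
  then have "integrable (return borel (0::real) \<Otimes>\<^sub>M ?Q) (\<lambda>(\<omega>, F). \<Sum>s<t. ?c s F)"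
    by (subst pair.integrable_product_swap_iff[symmetric]) (simp add: case_prod_unfold)
  from pair.integral_snd[OF this]
  have "(\<integral>(\<omega>, F). (\<Sum>s<t. ?c s F) \<partial>(return borel (0::real) \<Otimes>\<^sub>M ?Q)) = (\<integral>F. (\<Sum>s<t. ?c s F) \<partial>?Q)"
    using seed.prob_space by simp
  also have "\<dots> = (\<Sum>s<t. \<integral>F. ?c s F \<partial>?Q)"
    by (intro Bochner_Integration.integral_sum integrable_mean_payoff_leader) simp
  finally show ?thesis
    unfolding regret_def chosen_follow_the_leader
    by (simp add: follow_the_leader_def sum_subtractf)
qed

end

section \<open>Summing the losses and choosing the nets\<close>

lemma regret_powr_bound:
  fixes p :: real and t\<^sub>0 :: nat
  assumes P: "lipschitz_instance P" and p: "0 < p" "p < 1"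
    and net: "\<And>s. s \<ge> t\<^sub>0 \<Longrightarrow> net s \<noteq> [] \<and>
        ln (card (set (net s))) \<le> (real s + 1) powr (2 * p - 1) \<and>
        (\<forall>x. \<exists>y\<in>set (net s). dist x y \<le> (real s + 1) powr (p - 1))"
    and "t\<^sub>0 \<ge> 1"
  shows "regret (follow_the_leader net) P t \<le> (t\<^sub>0 + 6 / p) * real t powr p"
proof (cases "t = 0")
  case True
  then show ?thesis by (simp add: regret_follow_the_leader[OF P])
next
  case False
  define g where "g = (\<lambda>s. (SUP x. mean_payoff P x) -
     (\<integral>F. mean_payoff P (arg_max_on (\<lambda>x. \<Sum>i\<in>{s div 2..<s}. F i x) (set (net s)))
        \<partial>(\<Pi>\<^sub>M s\<in>(UNIV :: nat set). P)))"
  have late: "g s \<le> 6 * (real s + 1) powr (p - 1)" if "s \<ge> t\<^sub>0" for s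
  proof -
    let ?x = "real s + 1"
    let ?n = "real (card {s div 2..<s})"
    have s: "s \<ge> 1" using that \<open>t\<^sub>0 \<ge> 1\<close> by simp
    \<comment> \<open>The window has at least s / 2 rounds, and s / 2 >= (s + 1) / 4 once s >=
      1.\<close>
    then have n: "?x / 4 \<le> ?n" by (simp add: of_nat_diff field_simps)
    \<comment> \<open>Net radius and exponential parameter \<open>l\<close> are both set to
      \<open>?x powr (p - 1)\<close>. With \<open>ln (card S)\<close> at most
      \<open>?x powr (2 * p - 1)\<close>, all three error terms have this order, with factors 1, 4
      and 1 / 8.\<close>
    have "g s \<le> ?x powr (p - 1) + ln (card (set (net s))) / (?n * ?x powr (p - 1))
        + ?x powr (p - 1) / 8"
      unfolding g_def using net[OF that] s by (intro expected_gap_leader[OF P]) auto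
    also have "ln (card (set (net s))) / (?n * ?x powr (p - 1))
        \<le> ?x powr (2 * p - 1) / (?x / 4 * ?x powr (p - 1))"
      using net[OF that] n by (intro frac_le mult_right_mono) auto
    also have "\<dots> = 4 * ?x powr (p - 1)"
    proof -
      have "?x powr (2 * p - 1) = ?x powr (1 + (p - 1) + (p - 1))" by simp
      also have "\<dots> = ?x * ?x powr (p - 1) * ?x powr (p - 1)" by (simp only: powr_add) simp
      finally show ?thesis by simp
    qed
    finally have "g s \<le> 41 / 8 * ?x powr (p - 1)" by simp
    also have "\<dots> \<le> 6 * ?x powr (p - 1)" by (intro mult_right_mono) auto
    finally show ?thesis .
  qed
  have "regret (follow_the_leader net) P t = (\<Sum>s<t. g s)"
    by (simp add: regret_follow_the_leader[OF P] g_def)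
  also have "\<dots> \<le> (\<Sum>s<t. (if s < t\<^sub>0 then 1 else 0) + 6 * (real s + 1) powr (p - 1))"
  proof (rule sum_mono)
    fix s
    have "g s \<le> 1" unfolding g_def by (rule expected_gap_leader_le_1[OF P])
    then show "g s \<le> (if s < t\<^sub>0 then 1 else 0) + 6 * (real s + 1) powr (p - 1)"
      using late[of s] by (auto intro: add_increasing2)
  qed
  also have "\<dots> = (\<Sum>s<t. if s < t\<^sub>0 then 1 else 0) + 6 * (\<Sum>s<t. (real s + 1) powr (p - 1))"
    by (simp add: sum.distrib sum_distrib_left)
  also have "(\<Sum>s<t. if s < t\<^sub>0 then 1 else 0) = real (card {s. s < t \<and> s < t\<^sub>0})"
    by (simp add: sum.If_cases lessThan_def Collect_conj_eq)
  also have "\<dots> \<le> real (card {..<t\<^sub>0})"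
    by (intro of_nat_mono card_mono) auto
  \<comment> \<open>As t >= 1, the power is at least 1 and absorbs the early rounds.\<close>
  also have "\<dots> \<le> t\<^sub>0 * real t powr p"
    using False p by (simp add: mult_le_cancel_left1 ge_one_powr_ge_zero)
  also have "(\<Sum>s<t. (real s + 1) powr (p - 1)) \<le> real t powr p / p"
    by (rule sum_powr_le[OF p])
  finally show ?thesis by (simp add: algebra_simps)
qed

theorem theorem6p3:
  fixes d \<gamma> :: real
  assumes "\<And>x y :: 'a::metric_space. dist x y \<le> 1"
    and "log_covering_dim (UNIV :: 'a set) = ereal d"
    and "\<gamma> > (d + 1) / (d + 2)"
  shows "experts_tractable TYPE('a) \<gamma>"
proof -
  have d: "d \<ge> 0" using log_covering_dim_nonneg[where 'a='a] assms(2) by simp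
  \<comment> \<open>The second entry is the midpoint of (d + 1) / (d + 2) and 1. It caps the
    exponent below 1, as the power sum bound requires, even when \<open>\<gamma>\<close> is
    large.\<close>
  define p where "p = min \<gamma> ((2 * d + 3) / (2 * d + 4))"
  \<comment> \<open>The solution of (1 - p) * (b + 2) = 1. Thus p > (d + 1) / (d + 2) says exactly b
    > d, and r = (s + 1) powr (p - 1) gives r powr - b = (s + 1) powr (2 * p - 1).\<close>
  define b where "b = 1 / (1 - p) - 2"
  have "(d + 1) / (d + 2) < (2 * d + 3) / (2 * d + 4)" "(2 * d + 3) / (2 * d + 4) < 1"
    "0 < (d + 1) / (d + 2)"
    using d by (simp_all add: field_simps)
  then have p: "(d + 1) / (d + 2) < p" "0 < p" "p < 1" "p \<le> \<gamma>"
    using assms(3) by (auto simp: p_def)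
  have "d < b"
    using p(1,3) d by (simp add: b_def field_simps)
  have bp: "(p - 1) * - b = 2 * p - 1"
    using p(3) by (simp add: b_def field_simps)
  define good where "good = (\<lambda>s (xs :: 'a list). xs \<noteq> [] \<and>
      ln (card (set xs)) \<le> (real s + 1) powr (2 * p - 1) \<and>
      (\<forall>x. \<exists>y\<in>set xs. dist x y \<le> (real s + 1) powr (p - 1)))"
  have scale: "filterlim (\<lambda>s. (real s + 1) powr (p - 1)) (at_right 0) sequentially"
    using p(3) by real_asymp
  have "\<forall>\<^sub>F s in sequentially. \<exists>S :: 'a set. finite S \<and> S \<noteq> {} \<and>
      ln (card S) \<le> ((real s + 1) powr (p - 1)) powr - b \<and>
      (\<forall>x. \<exists>y\<in>S. dist x y \<le> (real s + 1) powr (p - 1))"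
    using assms(2) \<open>d < b\<close>
    by (intro eventually_compose_filterlim[OF eventually_net_of_log_covering_dim scale]) simp
  \<comment> \<open>Requiring s >= 1 forces \<open>t\<^sub>0 >= 1\<close>, so every window from
    \<open>t\<^sub>0\<close> on is nonempty.\<close>
  then have "\<forall>\<^sub>F s in sequentially. s \<ge> 1 \<and> (\<exists>xs. good s xs)"
    using eventually_ge_at_top[of 1]
  proof eventually_elim
    case (elim s)
    then obtain S :: "'a set" where S: "finite S" "S \<noteq> {}"
        "ln (card S) \<le> (real s + 1) powr (2 * p - 1)"
        "\<forall>x. \<exists>y\<in>S. dist x y \<le> (real s + 1) powr (p - 1)"
      unfolding powr_powr bp by blast
    from finite_list[OF S(1)] obtain xs where "set xs = S" by blast
    with S have "good s xs" unfolding good_def by auto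
    with elim show ?case by blast
  qed
  then obtain t\<^sub>0 where t\<^sub>0: "\<And>s. s \<ge> t\<^sub>0 \<Longrightarrow> s \<ge> 1 \<and> (\<exists>xs. good s xs)"
    by (auto simp: eventually_sequentially)
  \<comment> \<open>The nets depend only on the space and p, so one algorithm serves all instances.
    Before \<open>t\<^sub>0\<close> the list may be arbitrary.\<close>
  define net where "net = (\<lambda>s. SOME xs. good s xs)"
  have net: "good s (net s)" if "s \<ge> t\<^sub>0" for s
    unfolding net_def by (rule someI_ex) (use t\<^sub>0[OF that] in blast)
  have "regret (follow_the_leader net) P t \<le> (t\<^sub>0 + 6 / p) * real t powr \<gamma>"
    if "lipschitz_instance P" for P t
  proof -
    have "regret (follow_the_leader net) P t \<le> (t\<^sub>0 + 6 / p) * real t powr p"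
      using t\<^sub>0[of t\<^sub>0] by (intro regret_powr_bound[OF that p(2,3) net[unfolded good_def]]) auto
    also have "\<dots> \<le> (t\<^sub>0 + 6 / p) * real t powr \<gamma>"
      using p by (cases "t = 0") (auto intro!: mult_left_mono powr_mono)
    finally show ?thesis .
  qed
  then show ?thesis
    unfolding experts_tractable_def using valid_follow_the_leader by blast
qed

end
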